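(* Let $f$ be a convex/concave function on $[a,b]$ with inflection point $p$, and let $x_{F1}$ and $x_{F2}$ be its xF-left and xF-right points (as defined in the context). Then $x_{F1}$ and $x_{F2}$ are solutions $x\in[a-\delta_1,b+\delta_2]$ of the equation $$f'(x)=\frac{f(b)-f(a)}{b-a}.$$
   Context: Setting: $f:[a,b]\to\mathbb{R}$ is of class $C^{n}$ with $n\ge 2$, convex on $[a,p]$ and concave on $[p,b]$, where $p$ is the unique inflection point of $f$ in $[a,b]$. When the interval $[a,b]$ has to be enlarged below, $f$ is understood to be defined and $C^n$ on the enlarged interval. The total chord is the line $y=g(x)$ through $(a,f(a))$ and $(b,f(b))$, and the distance from the total chord is $$F(x)=f(x)-g(x)=f(x)-\frac{(f(b)-f(a))\,x}{b-a}-\frac{b f(a)-a f(b)}{b-a}.$$ The xF-left and xF-right points are $$x_{F1}=\operatorname{argmin}_{x\in[a-\delta_1,b]}F(x),\qquad x_{F2}=\operatorname{argmax}_{x\in[a,b+\delta_2]}F(x),$$ with $\delta_1,\delta_2>0$ taken as small as necessary for $x_{F1}$, $x_{F2}$ to be unique unconstrained extremes in the corresponding intervals, i.e. each extremum is attained at exactly one point, and that point lies in the interior of the corresponding interval. *)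

theory Defs
  imports "HOL-Analysis.Analysis"
begin

text \<open>Class \<open>C\<^sup>n\<close> on a set \<open>S\<close>, intended for nondegenerate compact intervals: derivatives
  are taken within \<open>S\<close>, hence are one-sided at the end points.\<close>

primrec C_n_on :: "nat \<Rightarrow> (real \<Rightarrow> real) \<Rightarrow> real set \<Rightarrow> bool" where
  "C_n_on 0 f S \<longleftrightarrow> continuous_on S f"
| "C_n_on (Suc n) f S \<longleftrightarrow>
     (\<exists>f'. (\<forall>x\<in>S. (f has_real_derivative f' x) (at x within S)) \<and> C_n_on n f' S)"

definition strictly_convex_on :: "real set \<Rightarrow> (real \<Rightarrow> real) \<Rightarrow> bool" where
  "strictly_convex_on S f \<longleftrightarrow> convex S \<and>
     (\<forall>x\<in>S. \<forall>y\<in>S. \<forall>t. x \<noteq> y \<longrightarrow> 0 < t \<longrightarrow> t < 1 \<longrightarrow>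
        f ((1 - t) * x + t * y) < (1 - t) * f x + t * f y)"

definition strictly_concave_on :: "real set \<Rightarrow> (real \<Rightarrow> real) \<Rightarrow> bool" where
  "strictly_concave_on S f \<longleftrightarrow> strictly_convex_on S (\<lambda>x. - f x)"

text \<open>An inflection point of \<open>f : [a,b] \<rightarrow> \<real>\<close> is a point where the sense of convexity changes.
  The one-sided neighbourhoods must lie in \<open>[a,b]\<close>, so it is an interior point. Convexity and
  concavity are strict here, since otherwise every interior point of a line segment would qualify;
  a strict change of sign of \<open>f''\<close> at \<open>q\<close> is a special case.\<close>

definition inflection_point :: "(real \<Rightarrow> real) \<Rightarrow> real \<Rightarrow> real \<Rightarrow> real \<Rightarrow> bool" where
  "inflection_point f a b q \<longleftrightarrow>
     (\<exists>e>0. a \<le> q - e \<and> q + e \<le> b \<and>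
        (strictly_convex_on {q - e..q} f \<and> strictly_concave_on {q..q + e} f \<or>
         strictly_concave_on {q - e..q} f \<and> strictly_convex_on {q..q + e} f))"

definition total_chord :: "(real \<Rightarrow> real) \<Rightarrow> real \<Rightarrow> real \<Rightarrow> real \<Rightarrow> real" where
  "total_chord f a b x = (f b - f a) * x / (b - a) + (b * f a - a * f b) / (b - a)"

lemma total_chord_ends:
  assumes "a < b"
  shows "total_chord f a b a = f a" and "total_chord f a b b = f b"
proof -
  have "(f b - f a) * a + (b * f a - a * f b) = f a * (b - a)"
       "(f b - f a) * b + (b * f a - a * f b) = f b * (b - a)"
    by (simp_all add: algebra_simps)
  then show "total_chord f a b a = f a" and "total_chord f a b b = f b"
    using assms unfolding total_chord_def add_divide_distrib [symmetric] by simp_all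
qed

definition chord_distance :: "(real \<Rightarrow> real) \<Rightarrow> real \<Rightarrow> real \<Rightarrow> real \<Rightarrow> real" where
  "chord_distance f a b x = f x - total_chord f a b x"

text \<open>The last two conjuncts express that the extremum is unique and unconstrained. The parameter
  \<open>\<delta>\<close> is any enlargement for which this holds; no minimality of \<open>\<delta>\<close> is imposed.\<close>

definition is_xF_left :: "(real \<Rightarrow> real) \<Rightarrow> real \<Rightarrow> real \<Rightarrow> real \<Rightarrow> real \<Rightarrow> bool" where
  "is_xF_left f a b \<delta> x \<longleftrightarrow>
     is_arg_min (chord_distance f a b) (\<lambda>y. y \<in> {a - \<delta>..b}) x \<and>
     (\<forall>z. is_arg_min (chord_distance f a b) (\<lambda>y. y \<in> {a - \<delta>..b}) z \<longrightarrow> z = x) \<and>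
     x \<in> interior {a - \<delta>..b}"

definition is_xF_right :: "(real \<Rightarrow> real) \<Rightarrow> real \<Rightarrow> real \<Rightarrow> real \<Rightarrow> real \<Rightarrow> bool" where
  "is_xF_right f a b \<delta> x \<longleftrightarrow>
     is_arg_max (chord_distance f a b) (\<lambda>y. y \<in> {a..b + \<delta>}) x \<and>
     (\<forall>z. is_arg_max (chord_distance f a b) (\<lambda>y. y \<in> {a..b + \<delta>}) z \<longrightarrow> z = x) \<and>
     x \<in> interior {a..b + \<delta>}"

end

theory Submission
  imports Defs
begin

text \<open>This is Fermat's rule for stationary points. The chord is affine with slope
  \<open>(f b - f a) / (b - a)\<close>, so the derivative of the chord distance is that of
  \<open>f\<close> minus this slope (\<open>DERIV_chord_distance\<close>). Each xF-point is an
  extremum of the chord distance in the interior of its interval, so this difference vanishes there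
  (\<open>DERIV_at_chord_distance_extremum\<close>).\<close>

text \<open>\<open>C_n_on\<close> only provides derivatives within \<open>S\<close>; at an interior
  point the filter \<open>at x within S\<close> coincides with \<open>at x\<close>, so they become
  two-sided.\<close>

lemma C_n_on_imp_DERIV_interior:
  assumes "C_n_on n f S" and "n \<ge> 1" and "x \<in> interior S"
  obtains D where "(f has_real_derivative D) (at x)"
proof -
  obtain m where "n = Suc m"
    using assms(2) by (cases n) auto
  then obtain f' where "\<forall>y\<in>S. (f has_real_derivative f' y) (at y within S)"
    using assms(1) by auto
  then have "(f has_real_derivative f' x) (at x within S)"
    using assms(3) interior_subset by blast
  then show thesis
    using that at_within_interior[OF assms(3)] by simp
qed

lemma DERIV_chord_distance:
  assumes "(f has_real_derivative D) (at x)"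
  shows "(chord_distance f a b has_real_derivative D - (f b - f a) / (b - a)) (at x)"
  unfolding chord_distance_def [abs_def] total_chord_def
  \<comment> \<open>For \<open>a = b\<close> division by zero yields 0, so the chord and its slope
    both vanish; otherwise the quotient rule applies.\<close>
  by (cases "a = b") (auto intro!: derivative_eq_intros assms)

text \<open>The disjunction lets one argument serve both the minimum \<open>xF1\<close> and the
  maximum \<open>xF2\<close>. A ball around \<open>x\<close> inside \<open>S\<close> turns the
  extremum over \<open>S\<close> into a local one.\<close>

lemma DERIV_at_chord_distance_extremum:
  assumes "(f has_real_derivative D) (at x)" and "x \<in> interior S"
    and "(\<forall>y\<in>S. chord_distance f a b x \<le> chord_distance f a b y) \<or>
         (\<forall>y\<in>S. chord_distance f a b y \<le> chord_distance f a b x)"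
  shows "(f has_real_derivative (f b - f a) / (b - a)) (at x)"
proof -
  obtain e where "e > 0" and "ball x e \<subseteq> S"
    using assms(2) by (auto simp: mem_interior)
  then have e: "y \<in> S" if "\<bar>x - y\<bar> < e" for y
    using that by (auto simp: dist_real_def)
  have "D - (f b - f a) / (b - a) = 0"
    using assms(3)
  proof
    assume "\<forall>y\<in>S. chord_distance f a b x \<le> chord_distance f a b y"
    then show ?thesis
      using DERIV_local_min[OF DERIV_chord_distance[OF assms(1)] \<open>e > 0\<close>] e by blast
  next
    assume "\<forall>y\<in>S. chord_distance f a b y \<le> chord_distance f a b x"
    then show ?thesis
      using DERIV_local_max[OF DERIV_chord_distance[OF assms(1)] \<open>e > 0\<close>] e by blast
  qed
  then show ?thesis
    using assms(1) by simp
qed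

theorem lemma1p4:
  fixes f :: "real \<Rightarrow> real" and a b p \<delta>1 \<delta>2 xF1 xF2 :: real and n :: nat
  assumes "a < b" and "n \<ge> 2"
    and "\<delta>1 > 0" and "\<delta>2 > 0"
    and "C_n_on n f {a - \<delta>1..b + \<delta>2}"
    and "p \<in> {a..b}"
    and "convex_on {a..p} f" and "concave_on {p..b} f"
    and "inflection_point f a b p"
    and "\<forall>q\<in>{a..b}. inflection_point f a b q \<longrightarrow> q = p"
    and "is_xF_left f a b \<delta>1 xF1"
    and "is_xF_right f a b \<delta>2 xF2"
  shows "xF1 \<in> {a - \<delta>1..b + \<delta>2} \<and>
         (f has_real_derivative (f b - f a) / (b - a)) (at xF1) \<and>
         xF2 \<in> {a - \<delta>1..b + \<delta>2} \<and>
         (f has_real_derivative (f b - f a) / (b - a)) (at xF2)"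
proof -
  let ?I = "{a - \<delta>1..b + \<delta>2}"
  have left: "xF1 \<in> interior {a - \<delta>1..b}"
      "\<forall>y\<in>{a - \<delta>1..b}. chord_distance f a b xF1 \<le> chord_distance f a b y"
    using assms(11) by (auto simp: is_xF_left_def is_arg_min_def not_less)
  have right: "xF2 \<in> interior {a..b + \<delta>2}"
      "\<forall>y\<in>{a..b + \<delta>2}. chord_distance f a b y \<le> chord_distance f a b xF2"
    using assms(12) by (auto simp: is_xF_right_def is_arg_max_def not_less)
  \<comment> \<open>Smoothness is given on the enlarged interval \<open>?I\<close>, whereas each
    extremum is taken over a subinterval; as both \<delta>s are positive, interior points of the
    subintervals are interior to \<open>?I\<close>.\<close>
  have int: "xF1 \<in> interior ?I" "xF2 \<in> interior ?I"
    using left(1) right(1) assms(3,4) by (auto simp: interior_atLeastAtMost_real)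
  have "n \<ge> 1"
    using assms(2) by simp
  then obtain D1 D2 where D: "(f has_real_derivative D1) (at xF1)" "(f has_real_derivative D2) (at xF2)"
    using C_n_on_imp_DERIV_interior[OF assms(5)] int by metis
  show ?thesis
    using DERIV_at_chord_distance_extremum[OF D(1) left(1)] left(2)
      DERIV_at_chord_distance_extremum[OF D(2) right(1)] right(2)
      int interior_subset by blast
qed

end
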